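(* Let $(\Omega_k,\mathcal{B}_k,\mu_k)$, $k=1,2$, be measure spaces and let $1\le p\le q\le\infty$. Let $A:L_p^{\mathbb{C}}(\mu_1)\to L_q^{\mathbb{C}}(\mu_2)$ be a $\mathbb{C}$-linear operator satisfying $A(L_p^{\mathbb{R}}(\mu_1))\subseteq L_q^{\mathbb{R}}(\mu_2)$. Then $\|A\|_{p,q}^{\mathbb{R}}=\|A\|_{p,q}^{\mathbb{C}}$.
   Context: For a measure space $(\Omega,\mathcal{B},\mu)$ ($\mu$ a positive measure), $p\in[1,\infty]$ and $\mathbb{F}=\mathbb{R}$ or $\mathbb{C}$, $L_p^{\mathbb{F}}(\mu)$ is the usual Banach space of $\mathcal{B}$-measurable functions $x:\Omega\to\mathbb{F}$ (identified when equal almost everywhere) with $\|x\|_p<\infty$, where $\|x\|_p=\left(\int_\Omega|x(t)|^p\,d\mu_t\right)^{1/p}$ for $p<\infty$ and $\|x\|_\infty=\operatorname{ess\,sup}_{t\in\Omega}|x(t)|$. The operator need not be bounded; define, with values in $[0,\infty]$, $$\|A\|_{p,q}^{\mathbb{F}}=\sup_{x\in L_p^{\mathbb{F}}(\mu_1)\setminus\{0\}}\frac{\|Ax\|_q}{\|x\|_p},\qquad \mathbb{F}=\mathbb{R}\text{ or }\mathbb{C}.$$ *)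

theory Defs
  imports "HOL-Probability.Essential_Supremum"
begin

text \<open>
  Exponents range over \<^typ>\<open>ennreal\<close>. There is no power function on \<^typ>\<open>ennreal\<close>, so the
  value \<open>\<infinity>\<close> of the integral is treated separately when taking the root.
\<close>

definition Lp_norm :: "ennreal \<Rightarrow> 'a measure \<Rightarrow> ('a \<Rightarrow> complex) \<Rightarrow> ennreal" where
  "Lp_norm p M f =
    (if p = \<infinity> then esssup M (\<lambda>t. ennreal (norm (f t)))
     else let I = (\<integral>\<^sup>+ t. ennreal (norm (f t) powr enn2real p) \<partial>M)
          in if I = \<infinity> then \<infinity> else ennreal (enn2real I powr (1 / enn2real p)))"

definition ae_class :: "'a measure \<Rightarrow> ('a \<Rightarrow> complex) \<Rightarrow> ('a \<Rightarrow> complex) set" where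
  "ae_class M f = {g \<in> borel_measurable M. AE t in M. g t = f t}"

text \<open>
  \<open>Lp_space \<real> p M\<close> and \<open>Lp_space UNIV p M\<close> are the real and the complex \<open>L\<^sub>p\<close> space: an element
  is the almost-everywhere class of a function with values in the scalar field \<open>F\<close>. The real
  space is thereby literally a subset of the complex one; its elements are the classes
  that contain a real-valued function (see \<open>Lp_space_Reals_iff\<close>).
\<close>

definition Lp_space :: "complex set \<Rightarrow> ennreal \<Rightarrow> 'a measure \<Rightarrow> ('a \<Rightarrow> complex) set set" where
  "Lp_space F p M =
    {ae_class M f | f. f \<in> borel_measurable M \<and> f ` space M \<subseteq> F \<and> Lp_norm p M f < \<infinity>}"

text \<open>The following do not depend on the representatives: see \<open>class_norm_ae_class\<close>,
  \<open>class_add_ae_class\<close> and \<open>class_scale_ae_class\<close>.\<close>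

definition class_norm :: "ennreal \<Rightarrow> 'a measure \<Rightarrow> ('a \<Rightarrow> complex) set \<Rightarrow> ennreal" where
  "class_norm p M X = the_elem (Lp_norm p M ` X)"

definition class_zero :: "'a measure \<Rightarrow> ('a \<Rightarrow> complex) set" where
  "class_zero M = ae_class M (\<lambda>t. 0)"

definition class_add ::
  "'a measure \<Rightarrow> ('a \<Rightarrow> complex) set \<Rightarrow> ('a \<Rightarrow> complex) set \<Rightarrow> ('a \<Rightarrow> complex) set" where
  "class_add M X Y = (\<Union>f\<in>X. \<Union>g\<in>Y. ae_class M (\<lambda>t. f t + g t))"

definition class_scale ::
  "'a measure \<Rightarrow> complex \<Rightarrow> ('a \<Rightarrow> complex) set \<Rightarrow> ('a \<Rightarrow> complex) set" where
  "class_scale M c X = (\<Union>f\<in>X. ae_class M (\<lambda>t. c * f t))"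

definition Lp_linear_operator ::
  "ennreal \<Rightarrow> 'a measure \<Rightarrow> ennreal \<Rightarrow> 'b measure
    \<Rightarrow> (('a \<Rightarrow> complex) set \<Rightarrow> ('b \<Rightarrow> complex) set) \<Rightarrow> bool" where
  "Lp_linear_operator p M q N A \<longleftrightarrow>
    A \<in> Lp_space UNIV p M \<rightarrow> Lp_space UNIV q N \<and>
    (\<forall>X \<in> Lp_space UNIV p M. \<forall>Y \<in> Lp_space UNIV p M.
        A (class_add M X Y) = class_add N (A X) (A Y)) \<and>
    (\<forall>c. \<forall>X \<in> Lp_space UNIV p M. A (class_scale M c X) = class_scale N c (A X))"

text \<open>For an operator into \<open>L\<^sub>q\<close> both norms in the quotient are finite and the denominator
  is nonzero, so the division is the usual one. The supremum of the empty set is \<open>0\<close>.\<close>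

definition operator_norm ::
  "complex set \<Rightarrow> ennreal \<Rightarrow> 'a measure \<Rightarrow> ennreal \<Rightarrow> 'b measure
    \<Rightarrow> (('a \<Rightarrow> complex) set \<Rightarrow> ('b \<Rightarrow> complex) set) \<Rightarrow> ennreal" where
  "operator_norm F p M q N A =
    (SUP X \<in> Lp_space F p M - {class_zero M}. class_norm q N (A X) / class_norm p M X)"

lemma ae_class_self: "f \<in> borel_measurable M \<Longrightarrow> f \<in> ae_class M f"
  by (simp add: ae_class_def)

lemma ae_class_eqI:
  assumes "AE t in M. f t = g t"
  shows "ae_class M f = ae_class M g"
  using assms unfolding ae_class_def by (auto elim: AE_mp)

lemma Lp_norm_cong_AE:
  assumes [measurable]: "f \<in> borel_measurable M" "g \<in> borel_measurable M"
    and "AE t in M. f t = g t"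
  shows "Lp_norm p M f = Lp_norm p M g"
proof -
  have "esssup M (\<lambda>t. ennreal (norm (f t))) = esssup M (\<lambda>t. ennreal (norm (g t)))"
    using assms(3) by (intro esssup_AE_cong) auto
  moreover have "(\<integral>\<^sup>+ t. ennreal (norm (f t) powr enn2real p) \<partial>M) =
      (\<integral>\<^sup>+ t. ennreal (norm (g t) powr enn2real p) \<partial>M)"
    using assms(3) by (intro nn_integral_cong_AE) auto
  ultimately show ?thesis
    by (simp add: Lp_norm_def)
qed

lemma class_norm_ae_class:
  assumes "f \<in> borel_measurable M"
  shows "class_norm p M (ae_class M f) = Lp_norm p M f"
proof -
  have "Lp_norm p M ` ae_class M f = {Lp_norm p M f}"
    using assms ae_class_self[OF assms]
    by (auto simp: ae_class_def intro: Lp_norm_cong_AE)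
  then show ?thesis
    by (simp add: class_norm_def)
qed

lemma class_add_ae_class:
  assumes "f \<in> borel_measurable M" "g \<in> borel_measurable M"
  shows "class_add M (ae_class M f) (ae_class M g) = ae_class M (\<lambda>t. f t + g t)"
proof -
  have "ae_class M (\<lambda>t. f' t + g' t) = ae_class M (\<lambda>t. f t + g t)"
    if "f' \<in> ae_class M f" "g' \<in> ae_class M g" for f' g'
  proof (rule ae_class_eqI)
    have "AE t in M. f' t = f t" "AE t in M. g' t = g t"
      using that by (auto simp: ae_class_def)
    then show "AE t in M. f' t + g' t = f t + g t"
      by eventually_elim simp
  qed
  then show ?thesis
    using ae_class_self[OF assms(1)] ae_class_self[OF assms(2)] unfolding class_add_def by blast
qed

lemma class_scale_ae_class:
  assumes "f \<in> borel_measurable M"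
  shows "class_scale M c (ae_class M f) = ae_class M (\<lambda>t. c * f t)"
proof -
  have "ae_class M (\<lambda>t. c * f' t) = ae_class M (\<lambda>t. c * f t)"
    if "f' \<in> ae_class M f" for f'
    using that by (intro ae_class_eqI) (auto simp: ae_class_def)
  then show ?thesis
    using ae_class_self[OF assms] unfolding class_scale_def by blast
qed

lemma Lp_space_Reals_iff:
  "X \<in> Lp_space \<real> p M \<longleftrightarrow>
    (\<exists>u :: 'a \<Rightarrow> real. u \<in> borel_measurable M \<and> X = ae_class M (\<lambda>t. complex_of_real (u t)) \<and>
      Lp_norm p M (\<lambda>t. complex_of_real (u t)) < \<infinity>)"
proof
  assume "X \<in> Lp_space \<real> p M"
  then obtain f where [measurable]: "f \<in> borel_measurable M" and X: "X = ae_class M f"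
    and F: "f ` space M \<subseteq> \<real>" and n: "Lp_norm p M f < \<infinity>"
    by (auto simp: Lp_space_def)
  have eq: "AE t in M. f t = complex_of_real (Re (f t))"
    using F by (intro AE_I2) (metis image_subset_iff of_real_Re)
  show "\<exists>u :: 'a \<Rightarrow> real. u \<in> borel_measurable M \<and> X = ae_class M (\<lambda>t. complex_of_real (u t)) \<and>
      Lp_norm p M (\<lambda>t. complex_of_real (u t)) < \<infinity>"
  proof (intro exI conjI)
    show "(\<lambda>t. Re (f t)) \<in> borel_measurable M" by simp
    show "X = ae_class M (\<lambda>t. complex_of_real (Re (f t)))"
      unfolding X by (rule ae_class_eqI[OF eq])
    have "Lp_norm p M f = Lp_norm p M (\<lambda>t. complex_of_real (Re (f t)))"
      by (intro Lp_norm_cong_AE[OF _ _ eq]) auto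
    with n show "Lp_norm p M (\<lambda>t. complex_of_real (Re (f t))) < \<infinity>" by simp
  qed
next
  assume "\<exists>u :: 'a \<Rightarrow> real. u \<in> borel_measurable M \<and> X = ae_class M (\<lambda>t. complex_of_real (u t)) \<and>
      Lp_norm p M (\<lambda>t. complex_of_real (u t)) < \<infinity>"
  then obtain u :: "'a \<Rightarrow> real" where [measurable]: "u \<in> borel_measurable M"
    and "X = ae_class M (\<lambda>t. complex_of_real (u t))"
    and "Lp_norm p M (\<lambda>t. complex_of_real (u t)) < \<infinity>"
    by blast
  then show "X \<in> Lp_space \<real> p M"
    unfolding Lp_space_def by (intro CollectI exI[of _ "\<lambda>t. complex_of_real (u t)"]) auto
qed

end

theory Submission
  imports Defs
begin

text \<open>
  The real space is part of the complex one, so only the inequality \<open>\<parallel>A\<parallel>\<^sup>\<complex> \<le> \<parallel>A\<parallel>\<^sup>\<real>\<close> needs an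
  argument. Let \<open>C\<close> be the real norm, which may be taken finite, and let \<open>y = A x\<close>. Since
  \<open>A\<close> is complex linear and preserves real functions, it commutes with taking real parts
  (\<open>linear_operator_Re\<close>). Applied to \<open>a x\<close> for every complex \<open>a\<close> of modulus one, this gives
  \<open>\<parallel>Re (a y)\<parallel>\<^sub>q \<le> C \<parallel>Re (a x)\<parallel>\<^sub>p\<close>. The rest no longer mentions \<open>A\<close>: one has to pass from all
  rotations \<open>a\<close> to \<open>\<parallel>y\<parallel>\<^sub>q \<le> C \<parallel>x\<parallel>\<^sub>p\<close> (\<open>Lp_norm_le_of_rotations\<close>).

  For \<open>q = \<infinity>\<close> the right-hand sides are at most \<open>C \<parallel>x\<parallel>\<^sub>p\<close>, and \<open>\<bar>y t\<bar>\<close> is the supremum of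
  \<open>\<bar>Re (a y t)\<bar>\<close> over a countable dense set of rotations.

  For \<open>q < \<infinity>\<close> one averages the \<open>q\<close>-th powers over the rotations. On the left the average
  of \<open>\<bar>Re (a z)\<bar>\<^sup>q\<close> is a fixed positive multiple \<open>c \<bar>z\<bar>\<^sup>q\<close>. On the right stands
  \<open>(\<integral>\<bar>Re (a x)\<bar>\<^sup>p)\<close> to the power \<open>q / p \<ge> 1\<close>; writing \<open>x = \<bar>x\<bar> sgn x\<close> and applying Jensen's
  inequality for the weight \<open>\<bar>x\<bar>\<^sup>p\<close>, this is at most
  \<open>(\<integral>\<bar>x\<bar>\<^sup>p)\<close> to the power \<open>q / p - 1\<close> times \<open>\<integral>\<bar>x\<bar>\<^sup>p \<bar>Re (a sgn x)\<bar>\<^sup>q\<close>. Its average is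
  \<open>c (\<integral>\<bar>x\<bar>\<^sup>p)\<close> to the power \<open>q / p\<close>, the same constant \<open>c\<close> cancels, and the claim follows.
  This is where \<open>p \<le> q\<close> enters.

  An average over the whole circle would call for an interchange of integrals, which is
  delicate for measures that are not \<open>\<sigma>\<close>-finite. Averages over the \<open>n\<close>-th roots of unity
  need only finite sums. They are not exactly proportional to \<open>\<bar>z\<bar>\<^sup>q\<close>, but they are up to a
  factor \<open>1 + e\<close> for large \<open>n\<close> (\<open>root_power_sum_approximates_norm\<close>), and finally
  \<open>e\<close> tends to \<open>0\<close>.
\<close>

section \<open>Tangents to convex powers\<close>

text \<open>
  The graph of a convex power lies above its tangent at \<open>b\<close>. This is Young's inequality for the
  product of \<open>a\<close> and the power \<open>r - 1\<close> of \<open>b\<close>. It is used twice: for the Lipschitz bound below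
  and, integrated, as Jensen's inequality.
\<close>

lemma powr_ge_tangent:
  fixes a b r :: real
  assumes "0 \<le> a" "0 \<le> b" "1 \<le> r"
  shows "b powr r + r * b powr (r - 1) * (a - b) \<le> a powr r"
proof (cases "a = 0 \<or> b = 0")
  case True
  moreover have "b powr (r - 1) * b \<le> r * (b powr (r - 1) * b)"
    using assms mult_right_mono[of 1 r "b powr (r - 1) * b"] by simp
  ultimately show ?thesis
    using assms by (auto simp: powr_mult_base mult_ac right_diff_distrib)
next
  case False
  have "(a powr r) powr (1 / r) * (b powr r) powr (1 - 1 / r)
      \<le> 1 / r * a powr r + (1 - 1 / r) * b powr r"
    using assms False by (intro Youngs_inequality_0) auto
  moreover have "(a powr r) powr (1 / r) = a" "(b powr r) powr (1 - 1 / r) = b powr (r - 1)"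
    using assms by (auto simp: powr_powr right_diff_distrib)
  ultimately have "r * (a * b powr (r - 1)) \<le> r * (1 / r * a powr r + (1 - 1 / r) * b powr r)"
    using assms by (intro mult_left_mono) auto
  also have "\<dots> = a powr r + (r - 1) * b powr r"
    using assms by (simp add: field_simps)
  finally have "r * (a * b powr (r - 1)) \<le> a powr r + (r - 1) * b powr r" .
  moreover have "b powr (r - 1) * b = b powr r"
    using assms False by (simp add: powr_diff)
  ultimately show ?thesis
    by (simp add: algebra_simps)
qed

lemma powr_lipschitz_unit_interval:
  fixes a b r :: real
  assumes "a \<in> {0..1}" "b \<in> {0..1}" "1 \<le> r"
  shows "\<bar>a powr r - b powr r\<bar> \<le> r * \<bar>a - b\<bar>"
proof -
  have *: "y powr r - x powr r \<le> r * \<bar>x - y\<bar>" if "x \<in> {0..1}" "y \<in> {0..1}" for x y :: real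
  proof -
    have "y powr r - x powr r \<le> r * (y powr (r - 1) * (y - x))"
      using powr_ge_tangent[of x y r] that assms by (simp add: algebra_simps)
    also have "y powr (r - 1) * (y - x) \<le> y powr (r - 1) * \<bar>x - y\<bar>"
      by (intro mult_left_mono) auto
    also have "\<dots> \<le> 1 * \<bar>x - y\<bar>"
      using that assms by (intro mult_right_mono powr_le1) auto
    finally show ?thesis
      using assms by simp
  qed
  show ?thesis
    using *[of a b] *[of b a] assms by (simp add: abs_if split: if_splits)
qed

section \<open>Averages over roots of unity\<close>

definition root_power_sum :: "real \<Rightarrow> nat \<Rightarrow> complex \<Rightarrow> real" where
  "root_power_sum q n z = (\<Sum>k<n. \<bar>Re (cis (2 * pi * real k / n) * z)\<bar> powr q)"

lemma root_power_sum_scale: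
  assumes "0 \<le> r"
  shows "root_power_sum q n (of_real r * z) = r powr q * root_power_sum q n z"
proof -
  have "Re (cis (2 * pi * real k / n) * (of_real r * z)) = r * Re (cis (2 * pi * real k / n) * z)"
    for k :: nat
    by (simp add: algebra_simps)
  then show ?thesis
    using assms by (simp add: root_power_sum_def abs_mult powr_mult sum_distrib_left)
qed

text \<open>
  A rotation by a root of unity permutes the roots, hence the summands: the sum is a periodic
  function of the argument of \<open>z\<close> with the small period \<open>2\<pi>/n\<close>.
\<close>

lemma root_power_sum_rotate:
  assumes "n > 0"
  shows "root_power_sum q n (cis (2 * pi * real j / n) * z) = root_power_sum q n z"
proof (induction j)
  case (Suc j)
  define f where "f k = \<bar>Re (cis (2 * pi * real k / n) * (cis (2 * pi * j / n) * z))\<bar> powr q" for k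
  have "f n = f 0"
    using assms by (simp add: f_def)
  have "cis (2 * pi * real k / n) * (cis (2 * pi * Suc j / n) * z) =
      cis (2 * pi * Suc k / n) * (cis (2 * pi * j / n) * z)" for k :: nat
  proof -
    have "cis a * (cis b * z) = cis (a + b) * z" for a b
      by (simp add: cis_mult flip: mult.assoc)
    then show ?thesis
      by (simp only: of_nat_Suc) (simp add: algebra_simps add_divide_distrib del: times_complex.sel)
  qed
  then have "root_power_sum q n (cis (2 * pi * Suc j / n) * z) = (\<Sum>k<n. f (Suc k))"
    by (simp only: root_power_sum_def f_def)
  also have "\<dots> = (\<Sum>k<n. f k)"
    using sum.lessThan_Suc[of f n] sum.lessThan_Suc_shift[of f n] \<open>f n = f 0\<close> by simp
  also have "\<dots> = root_power_sum q n z"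
    using Suc by (simp only: root_power_sum_def f_def)
  finally show ?case .
qed simp

lemma abs_Re_le_one:
  assumes "cmod a = 1" "cmod z \<le> 1"
  shows "\<bar>Re (a * z)\<bar> \<in> {0..1}"
  using abs_Re_le_cmod[of "a * z"] assms by (simp add: norm_mult)

lemma root_power_sum_lipschitz:
  assumes "1 \<le> q" "cmod z \<le> 1" "cmod w \<le> 1"
  shows "\<bar>root_power_sum q n z - root_power_sum q n w\<bar> \<le> n * (q * cmod (z - w))"
proof -
  have "\<bar>\<bar>Re (a * z)\<bar> powr q - \<bar>Re (a * w)\<bar> powr q\<bar> \<le> q * cmod (z - w)" if "cmod a = 1" for a
  proof -
    have "\<bar>\<bar>Re (a * z)\<bar> powr q - \<bar>Re (a * w)\<bar> powr q\<bar> \<le> q * \<bar>\<bar>Re (a * z)\<bar> - \<bar>Re (a * w)\<bar>\<bar>"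
      using assms that by (intro powr_lipschitz_unit_interval abs_Re_le_one)
    also have "\<bar>\<bar>Re (a * z)\<bar> - \<bar>Re (a * w)\<bar>\<bar> \<le> \<bar>Re (a * z) - Re (a * w)\<bar>"
      by simp
    also have "\<dots> \<le> cmod (z - w)"
      using abs_Re_le_cmod[of "a * (z - w)"] that
      unfolding norm_mult by (simp add: algebra_simps)
    finally show ?thesis
      using assms by simp
  qed
  then have "(\<Sum>k<n. \<bar>\<bar>Re (cis (2 * pi * real k / n) * z)\<bar> powr q - \<bar>Re (cis (2 * pi * real k / n) * w)\<bar> powr q\<bar>)
      \<le> (\<Sum>k<n. q * cmod (z - w))"
    by (intro sum_mono) (simp del: times_complex.sel)
  then have "\<bar>\<Sum>k<n. \<bar>Re (cis (2 * pi * real k / n) * z)\<bar> powr q - \<bar>Re (cis (2 * pi * real k / n) * w)\<bar> powr q\<bar>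
      \<le> (\<Sum>k<n. q * cmod (z - w))"
    by (rule order_trans[OF sum_abs])
  then show ?thesis
    by (simp add: root_power_sum_def sum_subtractf del: times_complex.sel)
qed

lemma cis_near_root_of_unity:
  fixes n :: nat
  assumes "n > 0" "cmod a = 1"
  shows "\<exists>j::nat. cmod (a - cis (2 * pi * j / n)) \<le> 2 * pi / n"
proof -
  obtain t where t: "0 \<le> t" "t < 2 * pi" "a = cis t"
    using Arg2pi_ge_0[of a] Arg2pi_lt_2pi[of a] Arg2pi_eq[of a] assms(2) that
    by (simp add: cis_conv_exp)
  define j where "j = nat \<lfloor>t * n / (2 * pi)\<rfloor>"
  have "real j \<le> t * n / (2 * pi)" "t * n / (2 * pi) < real j + 1"
    unfolding j_def using t by (auto simp: floor_less_iff)
  then have "2 * pi * j / n \<le> t" "t < 2 * pi * j / n + 2 * pi / n"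
    using assms by (simp_all add: field_simps)
  then have "\<bar>t - 2 * pi * j / n\<bar> \<le> 2 * pi / n"
    by auto
  moreover have "cmod (cis t - cis s) \<le> \<bar>t - s\<bar>" for s
  proof -
    have "cis t - cis s = cis s * (exp (\<i> * of_real (t - s)) - 1)"
      unfolding cis_conv_exp[symmetric] by (simp add: right_diff_distrib cis_mult)
    then show ?thesis
      using abs_sin_x_le_abs_x[of "(t - s) / 2"] dist_exp_i_1[of "t - s"] by (simp add: norm_mult)
  qed
  ultimately show ?thesis
    using t order_trans by blast
qed

text \<open>
  By periodicity, \<open>w\<close> may be moved to distance at most \<open>2\<pi>/n\<close> from \<open>z\<close>. Since the Lipschitz
  constant of the sum is \<open>n q\<close>, the oscillation on the circle stays bounded as \<open>n\<close> grows.
\<close>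

lemma root_power_sum_almost_constant:
  assumes "1 \<le> q" "n > 0" "cmod z = 1" "cmod w = 1"
  shows "root_power_sum q n z \<le> root_power_sum q n w + 2 * pi * q"
proof -
  have "cmod (z / w) = 1"
    using assms by (simp add: norm_divide)
  then obtain j :: nat where j: "cmod (z / w - cis (2 * pi * j / n)) \<le> 2 * pi / n"
    using cis_near_root_of_unity assms by blast
  define v where "v = cis (2 * pi * j / n) * w"
  have "w \<noteq> 0"
    using assms by auto
  then have "cmod (z - v) = cmod (z / w - cis (2 * pi * j / n)) * cmod w"
    by (simp add: v_def left_diff_distrib flip: norm_mult)
  then have "n * (q * cmod (z - v)) \<le> n * (q * (2 * pi / n))"
    using j assms by (intro mult_left_mono) auto
  then have "n * (q * cmod (z - v)) \<le> 2 * pi * q"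
    using assms by (simp add: mult_ac)
  moreover have "root_power_sum q n v = root_power_sum q n w"
    using assms by (simp add: v_def root_power_sum_rotate)
  moreover have "\<bar>root_power_sum q n z - root_power_sum q n v\<bar> \<le> n * (q * cmod (z - v))"
    using assms by (intro root_power_sum_lipschitz) (auto simp: v_def norm_mult)
  ultimately show ?thesis
    by linarith
qed

text \<open>
  The sum itself grows linearly with its number of terms, so the bounded oscillation becomes
  negligible. Taking a multiple of four terms makes \<open>\<i>\<close> one of the roots; then each real part may
  be paired with the imaginary part, and one of the two is at least \<open>1 / 2\<close>.
\<close>

lemma root_power_sum_lower_bound:
  assumes "1 \<le> q" "m > 0" "cmod z = 1"
  shows "2 * m * (1 / 2) powr q \<le> root_power_sum q (4 * m) z"
proof -
  let ?n = "4 * m"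
  have half: "(1 / 2) powr q \<le> \<bar>Re a\<bar> powr q + \<bar>Im a\<bar> powr q" if "cmod a = 1" for a
  proof -
    have "1 / 2 \<le> \<bar>Re a\<bar> \<or> 1 / 2 \<le> \<bar>Im a\<bar>"
      using cmod_le[of a] that by linarith
    then show ?thesis
    proof
      assume "1 / 2 \<le> \<bar>Re a\<bar>"
      then show ?thesis
        using assms by (intro add_increasing2 powr_mono2) auto
    next
      assume "1 / 2 \<le> \<bar>Im a\<bar>"
      then show ?thesis
        using assms by (intro add_increasing powr_mono2) auto
    qed
  qed
  have "cis (2 * pi * m / ?n) = \<i>"
    using assms by (simp add: complex_eq_iff)
  then have "root_power_sum q ?n z = root_power_sum q ?n (\<i> * z)"
    using root_power_sum_rotate[of ?n q m z] assms by simp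
  also have "\<dots> = (\<Sum>k<?n. \<bar>Im (cis (2 * pi * real k / ?n) * z)\<bar> powr q)"
  proof -
    have "\<bar>Re (a * (\<i> * z))\<bar> = \<bar>Im (a * z)\<bar>" for a
      by (simp add: algebra_simps)
    then show ?thesis
      unfolding root_power_sum_def by presburger
  qed
  finally have "2 * root_power_sum q ?n z =
      (\<Sum>k<?n. \<bar>Re (cis (2 * pi * real k / ?n) * z)\<bar> powr q + \<bar>Im (cis (2 * pi * real k / ?n) * z)\<bar> powr q)"
    by (simp only: root_power_sum_def sum.distrib mult_2)
  also have "\<dots> \<ge> (\<Sum>k<?n. (1 / 2) powr q)"
    using assms by (intro sum_mono half) (simp add: norm_mult)
  finally show ?thesis
    by simp
qed

text \<open>
  The constant \<open>c\<close> stands for \<open>n\<close> times the mean of \<open>\<bar>cos\<bar>\<^sup>q\<close> over the circle, up to a factor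
  close to one; its value is irrelevant because it cancels in the application.
\<close>

lemma root_power_sum_approximates_norm:
  fixes q e :: real
  assumes "1 \<le> q" "0 < e"
  obtains n c where "0 < c"
    "\<And>z. c * cmod z powr q \<le> root_power_sum q n z"
    "\<And>z. root_power_sum q n z \<le> (1 + e) * c * cmod z powr q"
proof -
  \<comment> \<open>The number of roots is chosen such that the oscillation d = 2 pi q
    satisfies G 1 + d \<le> (1 + e) (G 1 - d).\<close>
  obtain m :: nat where m: "2 * pi * q * (2 + e) / (e * (2 * (1 / 2) powr q)) < m"
    using reals_Archimedean2 by blast
  have "0 \<le> 2 * pi * q * (2 + e) / (e * (2 * (1 / 2) powr q))"
    using assms by simp
  with m have "0 < real m"
    by (rule le_less_trans[rotated])
  then have "m > 0"
    by simp
  define d where "d = 2 * pi * q"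
  define G where "G = root_power_sum q (4 * m)"
  have "d * (2 + e) < e * (2 * m * (1 / 2) powr q)"
    using m assms by (simp add: d_def field_simps)
  also have "\<dots> \<le> e * G 1"
    unfolding G_def using root_power_sum_lower_bound[of q m 1] assms \<open>m > 0\<close>
    by (intro mult_left_mono) auto
  finally have big: "d * (2 + e) < e * G 1" .
  have "0 < d"
    using assms by (simp add: d_def)
  then have "d * e < e * G 1"
    using big by (simp add: algebra_simps)
  then have pos: "0 < G 1 - d"
    using assms by simp
  have "G 1 + d \<le> (1 + e) * (G 1 - d)"
    using big by (simp add: algebra_simps)
  then have unit: "G 1 - d \<le> G z \<and> G z \<le> (1 + e) * (G 1 - d)" if "cmod z = 1" for z
    using root_power_sum_almost_constant[of q "4 * m" z 1]
      root_power_sum_almost_constant[of q "4 * m" 1 z] assms \<open>m > 0\<close> that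
    by (auto simp: G_def d_def)
  have scale: "G z = cmod z powr q * G (sgn z)" for z
    using root_power_sum_scale[of "cmod z" q "4 * m" "sgn z"] by (cases "z = 0") (auto simp: G_def sgn_eq)
  show thesis
  proof (rule that[OF pos, of "4 * m"])
    fix z :: complex
    have "cmod z powr q * (G 1 - d) \<le> G z \<and> G z \<le> cmod z powr q * ((1 + e) * (G 1 - d))"
    proof (cases "z = 0")
      case False
      then show ?thesis
        unfolding scale[of z] using unit[of "sgn z"] by (intro conjI mult_left_mono) (auto simp: norm_sgn)
    qed (use scale[of 0] in simp)
    then show "(G 1 - d) * cmod z powr q \<le> root_power_sum q (4 * m) z"
      "root_power_sum q (4 * m) z \<le> (1 + e) * (G 1 - d) * cmod z powr q"
      unfolding G_def by (simp_all only: mult.commute)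
  qed
qed

section \<open>Averaging integral inequalities over rotations\<close>

text \<open>
  Jensen's inequality for the finite measure with density \<open>w\<close>: integrate the tangent inequality
  at the mean value \<open>m\<close> of \<open>h\<close>. The linear term then vanishes. Only functions with values in
  the unit interval occur below, which makes all integrals exist.
\<close>

lemma weighted_integral_powr_le:
  fixes w h :: "'a \<Rightarrow> real"
  assumes w: "integrable M w" "\<And>t. 0 \<le> w t"
    and h [measurable]: "h \<in> borel_measurable M" and h01: "\<And>t. h t \<in> {0..1}"
    and r: "1 \<le> r"
  shows "(LINT t|M. w t * h t) powr r \<le> (LINT t|M. w t) powr (r - 1) * (LINT t|M. w t * h t powr r)"
proof -
  have [measurable]: "w \<in> borel_measurable M"
    using w by auto
  have wh_le: "w t * h t \<le> w t" and whr_le: "w t * h t powr r \<le> w t" for t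
    using w h01 r by (auto intro!: mult_left_le powr_le1)
  have wh: "integrable M (\<lambda>t. w t * h t)" and whr: "integrable M (\<lambda>t. w t * h t powr r)"
    using w h01 wh_le whr_le by (auto intro!: Bochner_Integration.integrable_bound[OF w(1)])
  define P m where "P = (LINT t|M. w t)" and "m = (LINT t|M. w t * h t) / P"
  have wh_nonneg: "0 \<le> (LINT t|M. w t * h t)" "(LINT t|M. w t * h t) \<le> P"
    unfolding P_def using w h01 wh wh_le by (auto intro!: integral_nonneg_AE integral_mono)
  show ?thesis
  proof (cases "P = 0")
    case True
    then show ?thesis
      using wh_nonneg w by (auto intro!: mult_nonneg_nonneg integral_nonneg_AE)
  next
    case False
    then have P: "0 < P" and m: "0 \<le> m" "m * P = (LINT t|M. w t * h t)"
      using wh_nonneg by (auto simp: m_def)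
    have "m powr r * P = (LINT t|M. m powr r * w t + r * m powr (r - 1) * (w t * h t - m * w t))"
      using w wh m by (simp add: P_def)
    also have "\<dots> \<le> (LINT t|M. w t * h t powr r)"
    proof (intro integral_mono)
      show "integrable M (\<lambda>t. m powr r * w t + r * m powr (r - 1) * (w t * h t - m * w t))"
        using w wh by auto
      fix t
      have "w t * (m powr r + r * m powr (r - 1) * (h t - m)) \<le> w t * h t powr r"
        using w h01 m r by (intro mult_left_mono powr_ge_tangent) auto
      then show "m powr r * w t + r * m powr (r - 1) * (w t * h t - m * w t) \<le> w t * h t powr r"
        by (simp add: algebra_simps)
    qed (rule whr)
    finally have "m powr r * P \<le> (LINT t|M. w t * h t powr r)" .
    then have "P powr (r - 1) * (m powr r * P) \<le> P powr (r - 1) * (LINT t|M. w t * h t powr r)"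
      by (intro mult_left_mono) auto
    moreover have "P powr (r - 1) * (m powr r * P) = (m * P) powr r"
      using P m(1) by (simp add: powr_mult powr_diff)
    ultimately show ?thesis
      using m by (simp add: P_def)
  qed
qed

lemma integrable_Re_powr:
  fixes f :: "'a \<Rightarrow> complex"
  assumes [measurable]: "f \<in> borel_measurable M"
    and "integrable M (\<lambda>t. cmod (f t) powr s)" "0 \<le> s" "cmod a = 1"
  shows "integrable M (\<lambda>t. \<bar>Re (a * f t)\<bar> powr s)"
proof (rule Bochner_Integration.integrable_bound[OF assms(2)])
  have "\<bar>Re (a * f t)\<bar> powr s \<le> cmod (f t) powr s" for t
    using abs_Re_le_cmod[of "a * f t"] assms by (intro powr_mono2) (auto simp: norm_mult)
  then show "AE t in M. norm (\<bar>Re (a * f t)\<bar> powr s) \<le> norm (cmod (f t) powr s)"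
    by auto
qed measurable

text \<open>
  The \<open>p\<close>-th power of \<open>x\<close> serves as the weight in Jensen's inequality, and the remaining factor
  depends on \<open>x\<close> through its direction \<open>sgn x\<close> alone. Where \<open>x\<close> vanishes, so does the weight.
\<close>

lemma Re_powr_integral_le:
  fixes x :: "'a \<Rightarrow> complex"
  assumes [measurable]: "x \<in> borel_measurable M"
    and x: "integrable M (\<lambda>t. cmod (x t) powr p)" and pq: "1 \<le> p" "p \<le> q" and a: "cmod a = 1"
  shows "(LINT t|M. \<bar>Re (a * x t)\<bar> powr p) powr (q / p)
    \<le> (LINT t|M. cmod (x t) powr p) powr (q / p - 1)
      * (LINT t|M. cmod (x t) powr p * \<bar>Re (a * sgn (x t))\<bar> powr q)"
proof -
  have "\<bar>Re (a * x t)\<bar> powr p = cmod (x t) powr p * \<bar>Re (a * sgn (x t))\<bar> powr p" for t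
  proof -
    have "Re (a * x t) = cmod (x t) * Re (a * sgn (x t))"
      by (cases "x t = 0") (auto simp: field_simps)
    then show ?thesis
      by (simp add: abs_mult powr_mult)
  qed
  moreover have "(\<bar>Re (a * sgn (x t))\<bar> powr p) powr (q / p) = \<bar>Re (a * sgn (x t))\<bar> powr q" for t
  proof -
    have "p * (q / p) = q"
      using pq by auto
    then show ?thesis
      by (simp only: powr_powr)
  qed
  moreover have "(LINT t|M. cmod (x t) powr p * \<bar>Re (a * sgn (x t))\<bar> powr p) powr (q / p)
    \<le> (LINT t|M. cmod (x t) powr p) powr (q / p - 1)
      * (LINT t|M. cmod (x t) powr p * (\<bar>Re (a * sgn (x t))\<bar> powr p) powr (q / p))"
  proof (rule weighted_integral_powr_le[OF x])
    fix t
    have "\<bar>Re (a * sgn (x t))\<bar> \<in> {0..1}"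
      using a by (intro abs_Re_le_one) (auto simp: norm_sgn)
    then show "\<bar>Re (a * sgn (x t))\<bar> powr p \<in> {0..1}"
      using pq by (auto intro: powr_le1)
  qed (use pq in \<open>auto simp: sgn_eq\<close>)
  ultimately show ?thesis
    by simp
qed

text \<open>
  Averaging over rotations, stated for \<open>q\<close>-th powers: add up the inequalities for the \<open>n\<close>-th
  roots of unity. The sums of \<open>\<bar>Re (a y)\<bar>\<^sup>q\<close> and of \<open>\<bar>Re (a sgn x)\<bar>\<^sup>q\<close> are almost \<open>c \<bar>y\<bar>\<^sup>q\<close>
  and at most about \<open>c\<close>, so that \<open>c\<close> cancels.
\<close>

lemma powr_integral_le_of_rotations:
  fixes x :: "'a \<Rightarrow> complex" and y :: "'b \<Rightarrow> complex"
  assumes [measurable]: "x \<in> borel_measurable M" "y \<in> borel_measurable N"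
    and x: "integrable M (\<lambda>t. cmod (x t) powr p)"
    and y: "integrable N (\<lambda>t. cmod (y t) powr q)"
    and pq: "1 \<le> p" "p \<le> q" and K: "0 \<le> K"
    and bound: "\<And>a. cmod a = 1 \<Longrightarrow>
      (LINT t|N. \<bar>Re (a * y t)\<bar> powr q) \<le> K * (LINT t|M. \<bar>Re (a * x t)\<bar> powr p) powr (q / p)"
  shows "(LINT t|N. cmod (y t) powr q) \<le> K * (LINT t|M. cmod (x t) powr p) powr (q / p)"
proof -
  define P where "P = (LINT t|M. cmod (x t) powr p)"
  define J where "J = (LINT t|N. cmod (y t) powr q)"
  have "0 \<le> P"
    unfolding P_def by (auto intro: integral_nonneg_AE)
  have approx: "J \<le> (1 + e) * (K * P powr (q / p))" if "0 < e" for e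
  proof -
    have "1 \<le> q"
      using pq by simp
    then obtain n c where c: "0 < c"
      and lower: "\<And>z. c * cmod z powr q \<le> root_power_sum q n z"
      and upper: "\<And>z. root_power_sum q n z \<le> (1 + e) * c * cmod z powr q"
      using root_power_sum_approximates_norm[OF _ \<open>0 < e\<close>, of q] by metis
    define a where "a k = cis (2 * pi * real k / real n)" for k :: nat
    have a: "cmod (a k) = 1" for k
      by (simp add: a_def)
    have G: "root_power_sum q n z = (\<Sum>k<n. \<bar>Re (a k * z)\<bar> powr q)" for z
      by (simp only: root_power_sum_def a_def)
    define g where "g k t = cmod (x t) powr p * \<bar>Re (a k * sgn (x t))\<bar> powr q" for k t
    have g_int: "integrable M (g k)" for k
    proof (rule Bochner_Integration.integrable_bound[OF x])
      show "g k \<in> borel_measurable M"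
        unfolding g_def sgn_eq by measurable
      have "\<bar>Re (a k * sgn (x t))\<bar> \<in> {0..1}" for t
        using a by (intro abs_Re_le_one) (auto simp: norm_sgn)
      then have "norm (g k t) \<le> norm (cmod (x t) powr p)" for t
        using pq unfolding g_def by (auto simp: abs_mult intro!: mult_left_le powr_le1)
      then show "AE t in M. norm (g k t) \<le> norm (cmod (x t) powr p)"
        by simp
    qed
    have Rey: "integrable N (\<lambda>t. \<bar>Re (a k * y t)\<bar> powr q)" for k
      using pq y a by (intro integrable_Re_powr) auto
    have "c * J = (LINT t|N. c * cmod (y t) powr q)"
      by (simp add: J_def)
    also have "\<dots> \<le> (LINT t|N. (\<Sum>k<n. \<bar>Re (a k * y t)\<bar> powr q))"
    proof (rule integral_mono)
      show "c * cmod (y t) powr q \<le> (\<Sum>k<n. \<bar>Re (a k * y t)\<bar> powr q)" for t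
        using lower[of "y t"] by (simp only: G)
    qed (use y Rey in \<open>auto simp del: times_complex.sel\<close>)
    also have "\<dots> = (\<Sum>k<n. (LINT t|N. \<bar>Re (a k * y t)\<bar> powr q))"
      using Rey by (intro Bochner_Integration.integral_sum)
    also have "\<dots> \<le> (\<Sum>k<n. K * (P powr (q / p - 1) * (LINT t|M. g k t)))"
    proof (rule sum_mono)
      fix k
      have "(LINT t|N. \<bar>Re (a k * y t)\<bar> powr q) \<le> K * (LINT t|M. \<bar>Re (a k * x t)\<bar> powr p) powr (q / p)"
        by (rule bound[OF a])
      also have "\<dots> \<le> K * (P powr (q / p - 1) * (LINT t|M. g k t))"
        unfolding g_def P_def using x pq a K by (intro mult_left_mono Re_powr_integral_le) auto
      finally show "(LINT t|N. \<bar>Re (a k * y t)\<bar> powr q) \<le> K * (P powr (q / p - 1) * (LINT t|M. g k t))" .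
    qed
    also have "\<dots> = K * (P powr (q / p - 1) * (\<Sum>k<n. (LINT t|M. g k t)))"
      by (simp only: sum_distrib_left)
    also have "(\<Sum>k<n. (LINT t|M. g k t)) = (LINT t|M. (\<Sum>k<n. g k t))"
      using g_int by (intro Bochner_Integration.integral_sum[symmetric])
    also have "K * (P powr (q / p - 1) * (LINT t|M. (\<Sum>k<n. g k t)))
        \<le> K * (P powr (q / p - 1) * (LINT t|M. (1 + e) * c * cmod (x t) powr p))"
    proof (intro mult_left_mono integral_mono)
      fix t
      have "(\<Sum>k<n. g k t) = cmod (x t) powr p * root_power_sum q n (sgn (x t))"
        by (simp only: g_def G sum_distrib_left)
      also have "\<dots> \<le> cmod (x t) powr p * ((1 + e) * c)"
      proof (intro mult_left_mono)
        have "root_power_sum q n (sgn (x t)) \<le> (1 + e) * c * cmod (sgn (x t)) powr q"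
          by (rule upper)
        also have "\<dots> \<le> (1 + e) * c"
          using c \<open>0 < e\<close> by (auto simp: norm_sgn)
        finally show "root_power_sum q n (sgn (x t)) \<le> (1 + e) * c" .
      qed auto
      finally show "(\<Sum>k<n. g k t) \<le> (1 + e) * c * cmod (x t) powr p"
        by (simp only: mult_ac)
    qed (use g_int x K in auto)
    also have "\<dots> = c * ((1 + e) * (K * (P powr (q / p - 1) * P)))"
      by (simp add: P_def)
    also have "P powr (q / p - 1) * P = P powr (q / p)"
      using \<open>0 \<le> P\<close> by (cases "P = 0") (auto simp: powr_diff)
    finally show ?thesis
      using c by simp
  qed
  \<comment> \<open>Let e tend to 0, in the form z = 1 / (1 + e) with z tending to 1 from below.\<close>
  have "J \<le> K * P powr (q / p)"
  proof (rule field_le_mult_one_interval)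
    fix z :: real
    assume z: "0 < z" "z < 1"
    then show "z * J \<le> K * P powr (q / p)"
      using approx[of "1 / z - 1"] by (simp add: field_simps)
  qed
  then show ?thesis
    by (simp add: J_def P_def)
qed

section \<open>Extended norms and their rotations\<close>

lemma Lp_norm_top: "Lp_norm top M f = esssup M (\<lambda>t. ennreal (cmod (f t)))"
  by (simp add: Lp_norm_def)

lemma Lp_norm_finite_exponent:
  assumes "p \<noteq> \<infinity>" "integrable M (\<lambda>t. cmod (f t) powr enn2real p)"
  shows "Lp_norm p M f = ennreal ((LINT t|M. cmod (f t) powr enn2real p) powr (1 / enn2real p))"
  using assms by (simp add: Lp_norm_def nn_integral_eq_integral integral_nonneg_AE)

lemma integrable_powr_if_Lp_norm_finite:
  assumes "p \<noteq> \<infinity>" and [measurable]: "f \<in> borel_measurable M" and "Lp_norm p M f < \<infinity>"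
  shows "integrable M (\<lambda>t. cmod (f t) powr enn2real p)"
proof (rule integrableI_nonneg)
  show "(\<integral>\<^sup>+ t. ennreal (cmod (f t) powr enn2real p) \<partial>M) < \<infinity>"
    using assms by (auto simp: Lp_norm_def Let_def less_top split: if_splits)
qed auto

lemma one_le_enn2real: "1 \<le> p \<Longrightarrow> p \<noteq> \<infinity> \<Longrightarrow> 1 \<le> enn2real p"
  by (cases p) auto

lemma Lp_norm_mono:
  assumes [measurable]: "f \<in> borel_measurable M" "g \<in> borel_measurable M"
    and le: "\<And>t. cmod (f t) \<le> cmod (g t)" and p: "1 \<le> p"
  shows "Lp_norm p M f \<le> Lp_norm p M g"
proof (cases "p = \<infinity> \<or> Lp_norm p M g = \<infinity>")
  case True
  then show ?thesis
    using le by (auto simp: Lp_norm_top intro!: esssup_mono ennreal_leI)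
next
  case finite: False
  then have p_fin: "p \<noteq> \<infinity>" and g: "Lp_norm p M g < \<infinity>"
    by (auto simp: less_top)
  let ?s = "enn2real p"
  have s: "1 \<le> ?s"
    using p p_fin by (rule one_le_enn2real)
  have pow_le: "cmod (f t) powr ?s \<le> cmod (g t) powr ?s" for t
    using le s by (intro powr_mono2) auto
  have int_g: "integrable M (\<lambda>t. cmod (g t) powr ?s)"
    using p_fin g by (intro integrable_powr_if_Lp_norm_finite) auto
  have int_f: "integrable M (\<lambda>t. cmod (f t) powr ?s)"
    using pow_le by (intro Bochner_Integration.integrable_bound[OF int_g]) auto
  show ?thesis
    unfolding Lp_norm_finite_exponent[OF p_fin int_f] Lp_norm_finite_exponent[OF p_fin int_g]
    using s by (intro ennreal_leI powr_mono2 integral_mono int_f int_g pow_le integral_nonneg_AE) auto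
qed

lemma Lp_norm_zero: "Lp_norm p M (\<lambda>t. 0) = 0"
proof -
  have "esssup M (\<lambda>t. 0 :: ennreal) \<le> 0"
    by (rule esssup_I) auto
  then show ?thesis
    by (simp add: Lp_norm_def)
qed

lemma AE_eq_zero_if_Lp_norm_zero:
  assumes [measurable]: "f \<in> borel_measurable M" and p: "1 \<le> p" and zero: "Lp_norm p M f = 0"
  shows "AE t in M. f t = 0"
proof (cases "p = \<infinity>")
  case True
  then have "esssup M (\<lambda>t. ennreal (cmod (f t))) = 0"
    using zero by (simp add: Lp_norm_top)
  with esssup_AE[of "\<lambda>t. ennreal (cmod (f t))" M] show ?thesis
    by auto
next
  case False
  have int: "integrable M (\<lambda>t. cmod (f t) powr enn2real p)"
    using False zero by (intro integrable_powr_if_Lp_norm_finite) auto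
  have "(LINT t|M. cmod (f t) powr enn2real p) = 0"
    using zero by (simp add: Lp_norm_finite_exponent[OF False int])
  then have "AE t in M. cmod (f t) powr enn2real p = 0"
    using int by (subst (asm) integral_nonneg_eq_0_iff_AE) auto
  then show ?thesis
    by auto
qed

lemma ae_class_eq_zero_if_Lp_norm_zero:
  assumes "f \<in> borel_measurable M" "1 \<le> p" "Lp_norm p M f = 0"
  shows "ae_class M f = class_zero M"
  unfolding class_zero_def by (rule ae_class_eqI) (rule AE_eq_zero_if_Lp_norm_zero[OF assms])

text \<open>
  At each point the modulus is attained by the rotation that makes the value positive. Since
  that rotation depends on the point, whereas an exceptional null set belongs to each rotation,
  only the countably many rational angles are used at first; the others follow by continuity.
\<close>

lemma Lp_norm_infinity_le_of_rotations:
  assumes [measurable]: "f \<in> borel_measurable M"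
    and bound: "\<And>a. cmod a = 1 \<Longrightarrow> Lp_norm \<infinity> M (\<lambda>t. of_real (Re (a * f t))) \<le> B"
  shows "Lp_norm \<infinity> M f \<le> B"
proof (cases "B = \<infinity>")
  case False
  define b where "b = enn2real B"
  have B: "B = ennreal b"
    using False by (simp add: b_def less_top)
  have "AE t in M. \<forall>s\<in>\<rat>. \<bar>Re (cis s * f t)\<bar> \<le> b"
  proof (rule AE_ball_countable')
    fix s :: real
    have "AE t in M. ennreal (cmod (of_real (Re (cis s * f t)))) \<le> Lp_norm \<infinity> M (\<lambda>t. of_real (Re (cis s * f t)))"
      unfolding Lp_norm_top infinity_ennreal_def by (rule esssup_AE)
    then show "AE t in M. \<bar>Re (cis s * f t)\<bar> \<le> b"
    proof eventually_elim
      case (elim t)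
      then have "ennreal \<bar>Re (cis s * f t)\<bar> \<le> ennreal b"
        using bound[of "cis s"] unfolding B norm_of_real by (auto intro: order_trans simp del: times_complex.sel)
      then show ?case
        by (simp add: b_def ennreal_le_iff del: times_complex.sel)
    qed
  qed (rule countable_rat)
  then have "AE t in M. ennreal (cmod (f t)) \<le> B"
  proof eventually_elim
    case (elim t)
    have "closed {s. \<bar>Re (cis s * f t)\<bar> \<le> b}"
      by (intro closed_Collect_le continuous_intros)
    then have "closure \<rat> \<subseteq> {s. \<bar>Re (cis s * f t)\<bar> \<le> b}"
      using elim by (intro closure_minimal) auto
    then have "\<bar>Re (cis (- Arg (f t)) * f t)\<bar> \<le> b"
      unfolding Rats_closure_real by blast
    moreover have "cis (- Arg (f t)) * f t = cmod (f t)"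
      by (subst (2) rcis_cmod_Arg[symmetric]) (simp add: rcis_def cis_mult)
    ultimately show ?case
      by (simp only: Re_complex_of_real abs_norm_cancel B ennreal_leI)
  qed
  then show ?thesis
    unfolding Lp_norm_top infinity_ennreal_def by (intro esssup_I) auto
qed simp

text \<open>
  For finite \<open>q\<close> the hypothesis is raised to the power \<open>q\<close>, which turns a power \<open>1 / p\<close> of
  the integral for \<open>x\<close> into the power \<open>q / p\<close>, the form that averaging can handle.
\<close>

lemma Lp_norm_le_of_rotations:
  assumes [measurable]: "x \<in> borel_measurable M" "y \<in> borel_measurable N"
    and pq: "1 \<le> p" "p \<le> q" and x: "Lp_norm p M x < \<infinity>" and y: "Lp_norm q N y < \<infinity>"
    and C: "C < \<infinity>"
    and bound: "\<And>a. cmod a = 1 \<Longrightarrow>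
      Lp_norm q N (\<lambda>t. of_real (Re (a * y t))) \<le> C * Lp_norm p M (\<lambda>t. of_real (Re (a * x t)))"
  shows "Lp_norm q N y \<le> C * Lp_norm p M x"
proof (cases "q = \<infinity>")
  case True
  have "Lp_norm \<infinity> N (\<lambda>t. of_real (Re (a * y t))) \<le> C * Lp_norm p M x" if "cmod a = 1" for a
  proof -
    have "cmod (of_real (Re (a * x t))) \<le> cmod (x t)" for t
      using abs_Re_le_cmod[of "a * x t"] that unfolding norm_of_real norm_mult by simp
    then have "C * Lp_norm p M (\<lambda>t. of_real (Re (a * x t))) \<le> C * Lp_norm p M x"
      using pq x by (intro mult_left_mono Lp_norm_mono) auto
    then show ?thesis
      using bound[OF that] unfolding True by (rule order_trans[rotated])
  qed
  then show ?thesis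
    unfolding True by (rule Lp_norm_infinity_le_of_rotations[OF assms(2)])
next
  case False
  with pq have p_fin: "p \<noteq> \<infinity>"
    by (auto simp: top_unique)
  define s r c where "s = enn2real p" and "r = enn2real q" and "c = enn2real C"
  have s: "1 \<le> s" and sr: "s \<le> r" and c: "0 \<le> c" "C = ennreal c"
    using pq False p_fin C by (auto simp: s_def r_def c_def one_le_enn2real enn2real_mono less_top)
  have int_x: "integrable M (\<lambda>t. cmod (x t) powr s)" and int_y: "integrable N (\<lambda>t. cmod (y t) powr r)"
    unfolding s_def r_def using x y p_fin False by (auto intro: integrable_powr_if_Lp_norm_finite)
  have "(LINT t|N. cmod (y t) powr r) \<le> c powr r * (LINT t|M. cmod (x t) powr s) powr (r / s)"
  proof (rule powr_integral_le_of_rotations[OF _ _ int_x int_y s sr])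
    fix a :: complex
    assume a: "cmod a = 1"
    let ?X = "LINT t|M. \<bar>Re (a * x t)\<bar> powr s" and ?Y = "LINT t|N. \<bar>Re (a * y t)\<bar> powr r"
    have "integrable M (\<lambda>t. cmod (of_real (Re (a * x t))) powr s)"
      "integrable N (\<lambda>t. cmod (of_real (Re (a * y t))) powr r)"
      unfolding norm_of_real using int_x int_y s sr a by (auto intro!: integrable_Re_powr simp del: times_complex.sel)
    then have "ennreal (?Y powr (1 / r)) \<le> ennreal c * ennreal (?X powr (1 / s))"
      using bound[OF a] unfolding s_def r_def c(2)
      by (simp add: Lp_norm_finite_exponent[OF False] Lp_norm_finite_exponent[OF p_fin] del: times_complex.sel)
    then have "?Y powr (1 / r) \<le> c * ?X powr (1 / s)"
      using c by (simp flip: ennreal_mult del: times_complex.sel)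
    then have "(?Y powr (1 / r)) powr r \<le> (c * ?X powr (1 / s)) powr r"
      using s sr by (intro powr_mono2) auto
    then show "?Y \<le> c powr r * ?X powr (r / s)"
      using s sr c by (simp add: powr_powr powr_mult integral_nonneg_AE del: times_complex.sel)
  qed auto
  then have "(LINT t|N. cmod (y t) powr r) powr (1 / r)
      \<le> (c powr r * (LINT t|M. cmod (x t) powr s) powr (r / s)) powr (1 / r)"
    using s sr by (intro powr_mono2 integral_nonneg_AE) auto
  also have "\<dots> = c * (LINT t|M. cmod (x t) powr s) powr (1 / s)"
    using s sr c by (simp add: powr_powr powr_mult)
  finally show ?thesis
    using int_x int_y c
    by (simp add: s_def r_def Lp_norm_finite_exponent[OF False] Lp_norm_finite_exponent[OF p_fin]
        ennreal_leI flip: ennreal_mult)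
qed

section \<open>Classes, real parts and the operator\<close>

lemma ae_class_eqD:
  assumes "f \<in> borel_measurable M" "ae_class M f = ae_class M g"
  shows "AE t in M. f t = g t"
  using ae_class_self[OF assms(1)] assms(2) by (auto simp: ae_class_def)

lemma Lp_space_iff:
  "X \<in> Lp_space UNIV p M \<longleftrightarrow> (\<exists>f \<in> borel_measurable M. X = ae_class M f \<and> Lp_norm p M f < \<infinity>)"
  by (auto simp: Lp_space_def)

lemma Lp_space_mono: "F \<subseteq> G \<Longrightarrow> Lp_space F p M \<subseteq> Lp_space G p M"
  unfolding Lp_space_def by blast

lemma real_part_in_Lp_space:
  assumes [measurable]: "f \<in> borel_measurable M" "u \<in> borel_measurable M"
    and "\<And>t. \<bar>u t\<bar> \<le> cmod (f t)" and "1 \<le> p" and "Lp_norm p M f < \<infinity>"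
  shows "ae_class M (\<lambda>t. of_real (u t)) \<in> Lp_space \<real> p M"
proof -
  have "Lp_norm p M (\<lambda>t. of_real (u t)) \<le> Lp_norm p M f"
    using assms by (intro Lp_norm_mono) auto
  with assms(5) show ?thesis
    unfolding Lp_space_Reals_iff by (intro exI[of _ u]) (auto intro: le_less_trans)
qed

lemma Lp_linear_operatorD:
  assumes "Lp_linear_operator p M q N A" and X: "X \<in> Lp_space UNIV p M"
  shows "A X \<in> Lp_space UNIV q N"
    and "Y \<in> Lp_space UNIV p M \<Longrightarrow> A (class_add M X Y) = class_add N (A X) (A Y)"
    and "A (class_scale M c X) = class_scale N c (A X)"
  using assms unfolding Lp_linear_operator_def by blast+

text \<open>
  Split \<open>x = u + \<i> v\<close> with \<open>u\<close> and \<open>v\<close> real. Then \<open>A x = A u + \<i> A v\<close>, where \<open>A u\<close> and \<open>A v\<close> are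
  real again, so \<open>A u\<close> is the real part of \<open>A x\<close>.
\<close>

lemma linear_operator_Re:
  assumes A: "Lp_linear_operator p M q N A" and real: "A ` Lp_space \<real> p M \<subseteq> Lp_space \<real> q N"
    and p: "1 \<le> p"
    and [measurable]: "x \<in> borel_measurable M" "y \<in> borel_measurable N"
    and x: "Lp_norm p M x < \<infinity>" and y: "A (ae_class M x) = ae_class N y"
  shows "A (ae_class M (\<lambda>t. of_real (Re (x t)))) = ae_class N (\<lambda>t. of_real (Re (y t)))"
proof -
  define U V where "U = ae_class M (\<lambda>t. complex_of_real (Re (x t)))"
    and "V = ae_class M (\<lambda>t. complex_of_real (Im (x t)))"
  have UV: "U \<in> Lp_space \<real> p M" "V \<in> Lp_space \<real> p M"
    unfolding U_def V_def using x p
    by (auto intro!: real_part_in_Lp_space[of x] abs_Re_le_cmod abs_Im_le_cmod)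
  then have UV': "U \<in> Lp_space UNIV p M" "V \<in> Lp_space UNIV p M"
    using Lp_space_mono[of \<real> UNIV p M] by auto
  have "A U \<in> Lp_space \<real> q N" "A V \<in> Lp_space \<real> q N"
    using UV real by auto
  then obtain u v :: "'b \<Rightarrow> real" where [measurable]: "u \<in> borel_measurable N" "v \<in> borel_measurable N"
    and u: "A U = ae_class N (\<lambda>t. of_real (u t))" and v: "A V = ae_class N (\<lambda>t. of_real (v t))"
    unfolding Lp_space_Reals_iff by blast
  have iV: "class_scale M \<i> V \<in> Lp_space UNIV p M"
  proof -
    have "Lp_norm p M (\<lambda>t. \<i> * complex_of_real (Im (x t))) \<le> Lp_norm p M x"
      using x p abs_Im_le_cmod by (intro Lp_norm_mono) (auto simp: norm_mult)
    then show ?thesis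
      unfolding V_def Lp_space_iff using x
      by (subst class_scale_ae_class) (auto intro!: bexI[of _ "\<lambda>t. \<i> * complex_of_real (Im (x t))"] intro: le_less_trans)
  qed
  have "ae_class M x = class_add M U (class_scale M \<i> V)"
    unfolding U_def V_def by (simp add: class_scale_ae_class class_add_ae_class flip: complex_eq)
  then have "ae_class N y = class_add N (A U) (class_scale N \<i> (A V))"
    using y UV' iV by (simp add: Lp_linear_operatorD[OF A])
  also have "\<dots> = ae_class N (\<lambda>t. of_real (u t) + \<i> * of_real (v t))"
    unfolding u v by (simp add: class_scale_ae_class class_add_ae_class)
  finally have "AE t in N. y t = of_real (u t) + \<i> * of_real (v t)"
    by (intro ae_class_eqD) auto
  then have "AE t in N. complex_of_real (u t) = of_real (Re (y t))"
    by eventually_elim simp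
  then show ?thesis
    unfolding U_def[symmetric] u by (rule ae_class_eqI)
qed

text \<open>
  The supremum leaves out the zero class, but the bound holds there as well because a linear
  operator maps the zero class to itself.
\<close>

lemma class_norm_le_operator_norm:
  assumes A: "Lp_linear_operator p M q N A" and p: "1 \<le> p" and X: "X \<in> Lp_space F p M"
  shows "class_norm q N (A X) \<le> operator_norm F p M q N A * class_norm p M X"
proof -
  obtain f where [measurable]: "f \<in> borel_measurable M" and f: "X = ae_class M f" "Lp_norm p M f < \<infinity>"
    using X unfolding Lp_space_def by blast
  have X': "X \<in> Lp_space UNIV p M"
    using X Lp_space_mono by blast
  show ?thesis
  proof (cases "X = class_zero M")
    case True
    then have "X = class_scale M 0 X"
      by (simp add: class_zero_def class_scale_ae_class)
    then have "A X = class_scale N 0 (A X)"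
      using Lp_linear_operatorD(3)[OF A X', of 0] by simp
    moreover obtain g where "g \<in> borel_measurable N" "A X = ae_class N g"
      using Lp_linear_operatorD(1)[OF A X'] unfolding Lp_space_iff by blast
    ultimately have "A X = ae_class N (\<lambda>t. 0)"
      by (simp add: class_scale_ae_class)
    then show ?thesis
      by (simp add: class_norm_ae_class Lp_norm_zero)
  next
    case False
    define d where "d = class_norm p M X"
    have "d < \<infinity>"
      using f by (simp add: d_def class_norm_ae_class)
    have "d \<noteq> 0"
      using False p ae_class_eq_zero_if_Lp_norm_zero[of f M p]
      by (auto simp: f d_def class_norm_ae_class)
    have "class_norm q N (A X) / d \<le> operator_norm F p M q N A"
      unfolding operator_norm_def d_def using X False by (intro SUP_upper) auto
    then have "class_norm q N (A X) / d * d \<le> operator_norm F p M q N A * d"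
      by (rule mult_right_mono) simp
    also have "class_norm q N (A X) / d * d = class_norm q N (A X)"
      using \<open>d < \<infinity>\<close> \<open>d \<noteq> 0\<close> by (simp add: ennreal_divide_times)
    finally show ?thesis
      by (simp add: d_def)
  qed
qed

section \<open>Equality of the real and the complex norm\<close>

theorem theorem3p1:
  fixes M1 :: "'a measure" and M2 :: "'b measure"
    and p q :: ennreal
    and A :: "('a \<Rightarrow> complex) set \<Rightarrow> ('b \<Rightarrow> complex) set"
  assumes "1 \<le> p" and "p \<le> q"
    and "Lp_linear_operator p M1 q M2 A"
    and "A ` Lp_space \<real> p M1 \<subseteq> Lp_space \<real> q M2"
  shows "operator_norm \<real> p M1 q M2 A = operator_norm UNIV p M1 q M2 A"
proof (rule antisym)
  show "operator_norm \<real> p M1 q M2 A \<le> operator_norm UNIV p M1 q M2 A"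
    unfolding operator_norm_def using Lp_space_mono[of \<real> UNIV] by (intro SUP_subset_mono) auto
  define C where "C = operator_norm \<real> p M1 q M2 A"
  show "operator_norm UNIV p M1 q M2 A \<le> C"
  proof (cases "C = \<infinity>")
    case False
    then have C: "C < \<infinity>"
      by (simp add: less_top)
    show ?thesis
      unfolding operator_norm_def
    proof (rule SUP_least)
      fix X
      assume "X \<in> Lp_space UNIV p M1 - {class_zero M1}"
      then obtain x where X: "X \<in> Lp_space UNIV p M1" "X \<noteq> class_zero M1" "X = ae_class M1 x"
        and [measurable]: "x \<in> borel_measurable M1" and x: "Lp_norm p M1 x < \<infinity>"
        by (auto simp: Lp_space_iff)
      obtain y where [measurable]: "y \<in> borel_measurable M2"
        and y: "A X = ae_class M2 y" "Lp_norm q M2 y < \<infinity>"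
        using Lp_linear_operatorD(1)[OF assms(3) X(1)] unfolding Lp_space_iff by blast
      have "Lp_norm q M2 y \<le> C * Lp_norm p M1 x"
      proof (rule Lp_norm_le_of_rotations[OF _ _ assms(1,2) x y(2) C])
        fix a :: complex
        assume a: "cmod a = 1"
        let ?u = "\<lambda>t. complex_of_real (Re (a * x t))" and ?v = "\<lambda>t. complex_of_real (Re (a * y t))"
        have "Lp_norm p M1 (\<lambda>t. a * x t) \<le> Lp_norm p M1 x"
          using assms(1) x a by (intro Lp_norm_mono) (auto simp: norm_mult)
        then have ax: "Lp_norm p M1 (\<lambda>t. a * x t) < \<infinity>"
          using x by (rule le_less_trans)
        have "A (class_scale M1 a X) = class_scale M2 a (A X)"
          by (rule Lp_linear_operatorD[OF assms(3) X(1)])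
        then have "A (ae_class M1 (\<lambda>t. a * x t)) = ae_class M2 (\<lambda>t. a * y t)"
          by (simp only: class_scale_ae_class X(3) y(1)[unfolded X(3)] \<open>x \<in> _\<close> \<open>y \<in> _\<close>)
        then have Au: "A (ae_class M1 ?u) = ae_class M2 ?v"
          using assms(1,3,4) ax by (intro linear_operator_Re) auto
        have "ae_class M1 ?u \<in> Lp_space \<real> p M1"
          using ax assms(1) by (intro real_part_in_Lp_space[of "\<lambda>t. a * x t"] abs_Re_le_cmod) auto
        then have "class_norm q M2 (A (ae_class M1 ?u)) \<le> C * class_norm p M1 (ae_class M1 ?u)"
          unfolding C_def using assms(1,3) by (intro class_norm_le_operator_norm)
        then show "Lp_norm q M2 ?v \<le> C * Lp_norm p M1 ?u"
          unfolding Au by (simp add: class_norm_ae_class del: times_complex.sel)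
      qed auto
      moreover have "Lp_norm p M1 x \<noteq> 0"
        using X(2,3) assms(1) ae_class_eq_zero_if_Lp_norm_zero[of x M1 p] by auto
      moreover have "class_norm q M2 (A X) = Lp_norm q M2 y" "class_norm p M1 X = Lp_norm p M1 x"
        unfolding y(1) by (simp_all add: X(3) class_norm_ae_class)
      ultimately show "class_norm q M2 (A X) / class_norm p M1 X \<le> C"
        by (simp add: divide_le_posI_ennreal mult.commute zero_less_iff_neq_zero)
    qed
  qed simp
qed

end
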